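(* Let $L=\{0,1,+,-,*,=,<\}$ and $L^-=\{0,1,+,*,=,<\}$, interpreted in the standard way in $\mathbb{Z}$ and in $\mathbb{N}$ respectively. Let $r\ge 1$ and let $D\subseteq\mathbb{N}^r$ be an $r$-ary relation on $\mathbb{N}$. Then $D$ has a functional conceptual substratum in the $L^-$-structure $\mathbb{N}$ if and only if $D$, regarded as an $r$-ary relation $D\subseteq\mathbb{Z}^r$, has a functional conceptual substratum in the $L$-structure $\mathbb{Z}$.
   Context: Here $\mathbb{N}$ contains $0$, and $-$ in $L$ denotes the additive inverse operation. Let $L'$ be a first-order language and $M$ an $L'$-structure. A relation $\Omega\subseteq M^r$ has a functional conceptual substratum (in $M$, with language $L'$) if there exist $L'$-terms $t_1,\ldots,t_r$ and atomic $L'$-formulas $A_1,\ldots,A_m$, all of whose variables are contained in $\{x_1,\ldots,x_n\}$, such that for all $a_1,\ldots,a_r\in M$: $(a_1,\ldots,a_r)\in\Omega$ if and only if $$M\models(\exists x_1)\cdots(\exists x_n)(a_1=t_1\wedge\cdots\wedge a_r=t_r\wedge A_1\wedge\cdots\wedge A_m).$$ *)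

theory Defs imports Main begin

(* First-order languages with equality. The index type of the variables is nat; the
   arity maps are partial, so that one type of symbols can serve a language and its
   sublanguages: the symbols of a language are those with a defined arity. *)

record ('f, 'p) language =
  fun_arity :: "'f \<Rightarrow> nat option"
  rel_arity :: "'p \<Rightarrow> nat option"

datatype 'f trm = Var nat | App 'f "'f trm list"

datatype ('f, 'p) atom = Eq "'f trm" "'f trm" | Rel 'p "'f trm list"

primrec trm_vars :: "'f trm \<Rightarrow> nat set" where
  "trm_vars (Var i) = {i}"
| "trm_vars (App f ts) = \<Union> (set (map trm_vars ts))"

fun is_term :: "('f, 'p) language \<Rightarrow> 'f trm \<Rightarrow> bool" where
  "is_term L (Var i) \<longleftrightarrow> True"
| "is_term L (App f ts) \<longleftrightarrow>
     fun_arity L f = Some (length ts) \<and> (\<forall>t\<in>set ts. is_term L t)"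

primrec atom_vars :: "('f, 'p) atom \<Rightarrow> nat set" where
  "atom_vars (Eq s t) = trm_vars s \<union> trm_vars t"
| "atom_vars (Rel p ts) = \<Union> (set (map trm_vars ts))"

primrec is_atomic :: "('f, 'p) language \<Rightarrow> ('f, 'p) atom \<Rightarrow> bool" where
  "is_atomic L (Eq s t) \<longleftrightarrow> is_term L s \<and> is_term L t"
| "is_atomic L (Rel p ts) \<longleftrightarrow>
     rel_arity L p = Some (length ts) \<and> (\<forall>t\<in>set ts. is_term L t)"

(* The universe of a structure is the whole type 'm. Interpretations take argument
   lists; only their values on symbols of the language at argument lists of the
   right length matter. *)

record ('f, 'p, 'm) fo_structure =
  fun_interp :: "'f \<Rightarrow> 'm list \<Rightarrow> 'm"
  rel_interp :: "'p \<Rightarrow> 'm list \<Rightarrow> bool"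

primrec trm_val :: "('f, 'p, 'm) fo_structure \<Rightarrow> (nat \<Rightarrow> 'm) \<Rightarrow> 'f trm \<Rightarrow> 'm" where
  "trm_val M x (Var i) = x i"
| "trm_val M x (App f ts) = fun_interp M f (map (trm_val M x) ts)"

primrec atom_holds :: "('f, 'p, 'm) fo_structure \<Rightarrow> (nat \<Rightarrow> 'm) \<Rightarrow> ('f, 'p) atom \<Rightarrow> bool" where
  "atom_holds M x (Eq s t) \<longleftrightarrow> trm_val M x s = trm_val M x t"
| "atom_holds M x (Rel p ts) \<longleftrightarrow> rel_interp M p (map (trm_val M x) ts)"

(* An r-ary relation is a set of lists of length r. The variables x_1, ..., x_n are
   Var 1, ..., Var n, so that quantifying over assignments x amounts to quantifying
   over the values of x_1, ..., x_n. *)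

definition has_functional_conceptual_substratum ::
  "('f, 'p) language \<Rightarrow> ('f, 'p, 'm) fo_structure \<Rightarrow> nat \<Rightarrow> 'm list set \<Rightarrow> bool" where
  "has_functional_conceptual_substratum L M r \<Omega> \<longleftrightarrow>
     (\<exists>n ts As.
        length ts = r \<and>
        (\<forall>t\<in>set ts. is_term L t \<and> trm_vars t \<subseteq> {1..n}) \<and>
        (\<forall>A\<in>set As. is_atomic L A \<and> atom_vars A \<subseteq> {1..n}) \<and>
        (\<forall>a. length a = r \<longrightarrow>
           (a \<in> \<Omega> \<longleftrightarrow>
            (\<exists>x. (\<forall>i<r. a ! i = trm_val M x (ts ! i)) \<and> (\<forall>A\<in>set As. atom_holds M x A)))))"

datatype fsym = Zero | One | Plus | Uminus | Times

datatype psym = Less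

definition lang_L :: "(fsym, psym) language" where
  "lang_L = \<lparr> fun_arity = [Zero \<mapsto> 0, One \<mapsto> 0, Plus \<mapsto> 2, Uminus \<mapsto> 1, Times \<mapsto> 2],
              rel_arity = [Less \<mapsto> 2] \<rparr>"

definition lang_L_minus :: "(fsym, psym) language" where
  "lang_L_minus = \<lparr> fun_arity = [Zero \<mapsto> 0, One \<mapsto> 0, Plus \<mapsto> 2, Times \<mapsto> 2],
                    rel_arity = [Less \<mapsto> 2] \<rparr>"

fun int_fun :: "fsym \<Rightarrow> int list \<Rightarrow> int" where
  "int_fun Zero [] = 0"
| "int_fun One [] = 1"
| "int_fun Plus [a, b] = a + b"
| "int_fun Uminus [a] = - a"
| "int_fun Times [a, b] = a * b"
| "int_fun _ _ = undefined"

fun nat_fun :: "fsym \<Rightarrow> nat list \<Rightarrow> nat" where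
  "nat_fun Zero [] = 0"
| "nat_fun One [] = 1"
| "nat_fun Plus [a, b] = a + b"
| "nat_fun Times [a, b] = a * b"
| "nat_fun _ _ = undefined"

fun less_rel :: "psym \<Rightarrow> 'm::linorder list \<Rightarrow> bool" where
  "less_rel Less [a, b] \<longleftrightarrow> a < b"
| "less_rel _ _ \<longleftrightarrow> undefined"

definition int_structure :: "(fsym, psym, int) fo_structure" where
  "int_structure = \<lparr> fun_interp = int_fun, rel_interp = less_rel \<rparr>"

definition nat_structure :: "(fsym, psym, nat) fo_structure" where
  "nat_structure = \<lparr> fun_interp = nat_fun, rel_interp = less_rel \<rparr>"

end

theory Submission imports Defs begin

text \<open>
  Each of the two structures can be simulated in the other by positive existential formulas that
  introduce only new variables, new equations and new inequalities. Since \<open><\<close> belongs to the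
  language, the natural numbers among the integers are given by an atomic formula, and the
  four-squares theorem can be avoided.

  From \<open>\<nat>\<close> to \<open>\<int>\<close>, the terms and atomic formulas are kept, and the atoms \<open>0 < x\<^sub>i + 1\<close> are added
  to confine the existential variables to the natural numbers. On such assignments the terms of
  the smaller language take the same values in both structures (\<open>trm_val_int_eq_nat\<close>).

  From \<open>\<int>\<close> to \<open>\<nat>\<close>, every integer variable is replaced by a difference \<open>u\<^sub>i - v\<^sub>i\<close> of two natural
  variables. Every term \<open>t\<close> then becomes a formal difference \<open>t\<^sup>+ - t\<^sup>-\<close> of terms without subtraction
  (\<open>trm_val_pm_part\<close>), and equations and inequalities between such differences are rewritten
  without subtraction by adding the negative parts to the other side (\<open>atom_holds_pm_atom\<close>). What
  remains are the terms \<open>t\<^sub>j\<close> that parametrise the relation, since a difference is not a term over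
  \<open>\<nat>\<close>: a fresh variable \<open>w\<^sub>j\<close> takes the place of \<open>t\<^sub>j\<close>, subject to the atom \<open>w\<^sub>j + t\<^sub>j\<^sup>- = t\<^sub>j\<^sup>+\<close>.
\<close>

section \<open>The two languages\<close>

abbreviation plus_trm :: "fsym trm \<Rightarrow> fsym trm \<Rightarrow> fsym trm" (infixl "\<^bold>+" 65) where
  "s \<^bold>+ t \<equiv> App Plus [s, t]"

abbreviation times_trm :: "fsym trm \<Rightarrow> fsym trm \<Rightarrow> fsym trm" (infixl "\<^bold>*" 70) where
  "s \<^bold>* t \<equiv> App Times [s, t]"

lemma length_eq_2_iff: "length xs = 2 \<longleftrightarrow> (\<exists>a b. xs = [a, b])"
  by (auto simp: numeral_2_eq_2 length_Suc_conv)

lemma language_simps [simp]: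
  "fun_arity lang_L Zero = Some 0" "fun_arity lang_L One = Some 0"
  "fun_arity lang_L Plus = Some 2" "fun_arity lang_L Uminus = Some 1"
  "fun_arity lang_L Times = Some 2" "rel_arity lang_L Less = Some 2"
  "fun_arity lang_L_minus Zero = Some 0" "fun_arity lang_L_minus One = Some 0"
  "fun_arity lang_L_minus Plus = Some 2" "fun_arity lang_L_minus Uminus = None"
  "fun_arity lang_L_minus Times = Some 2" "rel_arity lang_L_minus Less = Some 2"
  by (simp_all add: lang_L_def lang_L_minus_def)

lemma structure_simps [simp]:
  "fun_interp int_structure = int_fun" "rel_interp int_structure = less_rel"
  "fun_interp nat_structure = nat_fun" "rel_interp nat_structure = less_rel"
  by (simp_all add: int_structure_def nat_structure_def)

lemma lang_L_induct [consumes 1, case_names Var Zero One Plus Uminus Times]: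
  assumes "is_term lang_L t"
    and "\<And>i. P (Var i)" and "P (App Zero [])" and "P (App One [])"
    and "\<And>s t. is_term lang_L s \<Longrightarrow> is_term lang_L t \<Longrightarrow> P s \<Longrightarrow> P t \<Longrightarrow> P (s \<^bold>+ t)"
    and "\<And>t. is_term lang_L t \<Longrightarrow> P t \<Longrightarrow> P (App Uminus [t])"
    and "\<And>s t. is_term lang_L s \<Longrightarrow> is_term lang_L t \<Longrightarrow> P s \<Longrightarrow> P t \<Longrightarrow> P (s \<^bold>* t)"
  shows "P t"
  using assms(1)
proof (induction t)
  case (Var i)
  show ?case by (rule assms(2))
next
  case (App f ts)
  then show ?case
    by (cases f) (auto simp: length_eq_2_iff Suc_length_conv intro!: assms(3-))
qed

lemma is_term_lang_L_minus_imp_lang_L: "is_term lang_L_minus t \<Longrightarrow> is_term lang_L t"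
proof (induction t)
  case (App f ts)
  then show ?case by (cases f) auto
qed simp

lemma is_atomic_lang_L_minus_imp_lang_L: "is_atomic lang_L_minus A \<Longrightarrow> is_atomic lang_L A"
proof (cases A)
  case (Rel p ts)
  assume "is_atomic lang_L_minus A"
  with Rel show ?thesis
    by (cases p) (auto simp: is_term_lang_L_minus_imp_lang_L)
qed (auto simp: is_term_lang_L_minus_imp_lang_L)

lemma less_rel_map_int: "length as = 2 \<Longrightarrow> less_rel p (map int as) \<longleftrightarrow> less_rel p as"
  by (cases p) (auto simp: length_eq_2_iff)

lemma rel_arity_lang_L: "rel_arity lang_L p = Some 2"
  by (cases p) simp

section \<open>From the natural numbers to the integers\<close>

text \<open>
  Addition and multiplication of natural numbers are restrictions of those of the integers; the
  assumption concerns only the variables that occur, as the other ones may take negative values.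
\<close>

lemma trm_val_int_eq_nat:
  assumes "is_term lang_L_minus t" and "\<forall>i\<in>trm_vars t. x i = int (y i)"
  shows "trm_val int_structure x t = int (trm_val nat_structure y t)"
  using is_term_lang_L_minus_imp_lang_L [OF assms(1)] assms
  by (induction rule: lang_L_induct) auto

lemma atom_holds_int_iff_nat:
  assumes "is_atomic lang_L_minus A" and "\<forall>i\<in>atom_vars A. x i = int (y i)"
  shows "atom_holds int_structure x A \<longleftrightarrow> atom_holds nat_structure y A"
proof (cases A)
  case (Eq s t)
  with assms trm_val_int_eq_nat [of s x y] trm_val_int_eq_nat [of t x y] show ?thesis
    by simp
next
  case (Rel p ts)
  with assms have ts: "length ts = 2" "\<forall>t\<in>set ts. is_term lang_L_minus t"
    by (cases p; simp)+
  from assms(2) Rel ts(2)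
  have "map (trm_val int_structure x) ts = map int (map (trm_val nat_structure y) ts)"
    by (auto intro!: trm_val_int_eq_nat)
  then show ?thesis
    using Rel less_rel_map_int [of "map (trm_val nat_structure y) ts" p] ts(1) by (simp del: map_map)
qed

abbreviation nonneg_atom :: "nat \<Rightarrow> (fsym, psym) atom" where
  "nonneg_atom i \<equiv> Rel Less [App Zero [], Var i \<^bold>+ App One []]"

text \<open>
  With the added atoms every integer solution has nonnegative values on \<open>x\<^sub>1, \<dots>, x\<^sub>n\<close>, so truncation
  by \<^const>\<open>nat\<close> turns it into a solution over the natural numbers.
\<close>

lemma substratum_nat_imp_int:
  assumes "has_functional_conceptual_substratum lang_L_minus nat_structure r D"
  shows "has_functional_conceptual_substratum lang_L int_structure r (map int ` D)"
proof -
  from assms obtain n ts As where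
    len: "length ts = r" and
    ts: "\<forall>t\<in>set ts. is_term lang_L_minus t \<and> trm_vars t \<subseteq> {1..n}" and
    As: "\<forall>A\<in>set As. is_atomic lang_L_minus A \<and> atom_vars A \<subseteq> {1..n}" and
    D: "\<And>a. length a = r \<Longrightarrow> a \<in> D \<longleftrightarrow>
          (\<exists>y. (\<forall>i<r. a ! i = trm_val nat_structure y (ts ! i)) \<and>
               (\<forall>A\<in>set As. atom_holds nat_structure y A))"
    unfolding has_functional_conceptual_substratum_def by auto
  define Bs where "Bs = As @ map nonneg_atom [1..<Suc n]"
  have ts_val: "trm_val int_structure x (ts ! i) = int (trm_val nat_structure y (ts ! i))"
    if "\<forall>k\<in>{1..n}. x k = int (y k)" "i < r" for x y i
    using that ts len by (intro trm_val_int_eq_nat) (auto dest!: nth_mem)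
  have As_val: "atom_holds int_structure x A \<longleftrightarrow> atom_holds nat_structure y A"
    if "\<forall>k\<in>{1..n}. x k = int (y k)" "A \<in> set As" for x y A
    using that As by (intro atom_holds_int_iff_nat) auto
  have "a \<in> map int ` D \<longleftrightarrow>
          (\<exists>x. (\<forall>i<r. a ! i = trm_val int_structure x (ts ! i)) \<and>
               (\<forall>A\<in>set Bs. atom_holds int_structure x A))"
    (is "_ \<longleftrightarrow> ?R") if a: "length a = r" for a
  proof
    assume "a \<in> map int ` D"
    then obtain b where b: "b \<in> D" "a = map int b" by auto
    with D [of b] a obtain y where
      y: "\<forall>i<r. b ! i = trm_val nat_structure y (ts ! i)" "\<forall>A\<in>set As. atom_holds nat_structure y A"
      by auto
    have "\<forall>i<r. a ! i = trm_val int_structure (int \<circ> y) (ts ! i)"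
      using b a y(1) ts_val [of "int \<circ> y" y] by simp
    moreover have "\<forall>A\<in>set Bs. atom_holds int_structure (int \<circ> y) A"
      using y(2) As_val [of "int \<circ> y" y] by (auto simp: Bs_def)
    ultimately show ?R by blast
  next
    assume ?R
    then obtain x where x: "\<forall>i<r. a ! i = trm_val int_structure x (ts ! i)"
      "\<forall>A\<in>set Bs. atom_holds int_structure x A" by blast
    define y where "y = nat \<circ> x"
    have xy: "\<forall>k\<in>{1..n}. x k = int (y k)"
      using x(2) by (force simp: Bs_def y_def)
    define b where "b = map (\<lambda>t. trm_val nat_structure y t) ts"
    have "a = map int b"
      using a len x(1) ts_val [OF xy] by (intro nth_equalityI) (auto simp: b_def)
    moreover have "b \<in> D"
    proof -
      have "\<forall>A\<in>set As. atom_holds nat_structure y A"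
        using x(2) As_val [OF xy] by (auto simp: Bs_def)
      then show ?thesis using D [of b] len by (auto simp: b_def)
    qed
    ultimately show "a \<in> map int ` D" by blast
  qed
  moreover have "\<forall>t\<in>set ts. is_term lang_L t \<and> trm_vars t \<subseteq> {1..n}"
    using ts is_term_lang_L_minus_imp_lang_L by blast
  moreover have "\<forall>A\<in>set Bs. is_atomic lang_L A \<and> atom_vars A \<subseteq> {1..n}"
    using As is_atomic_lang_L_minus_imp_lang_L by (auto simp: Bs_def)
  ultimately show ?thesis
    using len unfolding has_functional_conceptual_substratum_def by blast
qed

section \<open>From the integers to the natural numbers\<close>

text \<open>
  The positive part (\<open>True\<close>) and the negative part (\<open>False\<close>) of a term. The variable \<open>x\<^sub>i\<close> becomes
  the difference of the variables with the indices \<open>3 * i + 1\<close> and \<open>3 * i + 2\<close>; the multiples of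
  \<open>3\<close> stay free for the variables that stand for the values of whole terms. The sign is an argument
  because the two parts are mutually recursive: \<open>Uminus\<close> swaps them and \<open>Times\<close> mixes them.
\<close>

fun pm_part :: "bool \<Rightarrow> fsym trm \<Rightarrow> fsym trm" where
  "pm_part b (Var i) = Var (if b then 3 * i + 1 else 3 * i + 2)"
| "pm_part b (App Plus [s, t]) = pm_part b s \<^bold>+ pm_part b t"
| "pm_part b (App Uminus [t]) = pm_part (\<not> b) t"
| "pm_part b (App Times [s, t]) =
     pm_part True s \<^bold>* pm_part b t \<^bold>+ pm_part False s \<^bold>* pm_part (\<not> b) t"
| "pm_part b (App One []) = (if b then App One [] else App Zero [])"
| "pm_part b t = App Zero []"

lemma is_term_pm_part: "is_term lang_L t \<Longrightarrow> is_term lang_L_minus (pm_part b t)"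
  by (induction arbitrary: b rule: lang_L_induct) auto

lemma trm_vars_pm_part:
  "is_term lang_L t \<Longrightarrow> trm_vars t \<subseteq> {1..n} \<Longrightarrow> trm_vars (pm_part b t) \<subseteq> {1..3 * n + 2}"
  by (induction arbitrary: b rule: lang_L_induct) auto

text \<open>
  The case of \<open>Times\<close> is the identity
  \<open>(p - q) * (p' - q') = (p * p' + q * q') - (p * q' + q * p')\<close>.
\<close>

lemma trm_val_pm_part:
  assumes "is_term lang_L t"
    and "\<forall>i\<in>trm_vars t. x i = int (y (3 * i + 1)) - int (y (3 * i + 2))"
  shows "trm_val int_structure x t =
    int (trm_val nat_structure y (pm_part True t)) - int (trm_val nat_structure y (pm_part False t))"
  using assms by (induction rule: lang_L_induct)
    (auto simp: left_diff_distrib right_diff_distrib)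

text \<open>
  Comparing \<open>s\<^sup>+ - s\<^sup>-\<close> with \<open>t\<^sup>+ - t\<^sup>-\<close> amounts to comparing \<open>s\<^sup>+ + t\<^sup>-\<close> with \<open>t\<^sup>+ + s\<^sup>-\<close>. The last equation
  is an arbitrary value for argument lists of the wrong length.
\<close>

fun pm_atom :: "(fsym, psym) atom \<Rightarrow> (fsym, psym) atom" where
  "pm_atom (Eq s t) = Eq (pm_part True s \<^bold>+ pm_part False t) (pm_part True t \<^bold>+ pm_part False s)"
| "pm_atom (Rel Less [s, t]) =
     Rel Less [pm_part True s \<^bold>+ pm_part False t, pm_part True t \<^bold>+ pm_part False s]"
| "pm_atom A = Eq (App Zero []) (App Zero [])"

lemma is_atomic_lang_L_cases:
  assumes "is_atomic lang_L A"
  obtains s t where "A = Eq s t \<or> A = Rel Less [s, t]" "is_term lang_L s" "is_term lang_L t"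
    "atom_vars A = trm_vars s \<union> trm_vars t"
proof (cases A)
  case (Eq s t)
  with assms show ?thesis by (intro that [of s t]) auto
next
  case (Rel p ts)
  with assms obtain s t where "ts = [s, t]"
    by (auto simp: rel_arity_lang_L length_eq_2_iff)
  with assms Rel show ?thesis by (cases p; intro that [of s t]) auto
qed

lemma is_atomic_pm_atom: "is_atomic lang_L A \<Longrightarrow> is_atomic lang_L_minus (pm_atom A)"
  by (erule is_atomic_lang_L_cases) (auto simp: is_term_pm_part)

lemma atom_vars_pm_atom:
  assumes "is_atomic lang_L A" and "atom_vars A \<subseteq> {1..n}"
  shows "atom_vars (pm_atom A) \<subseteq> {1..3 * n + 2}"
proof -
  from assms(1) obtain s t where st: "A = Eq s t \<or> A = Rel Less [s, t]"
    "is_term lang_L s" "is_term lang_L t" "atom_vars A = trm_vars s \<union> trm_vars t"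
    by (rule is_atomic_lang_L_cases)
  then have "atom_vars (pm_atom A) =
    (\<Union>b. trm_vars (pm_part b s) \<union> trm_vars (pm_part b t))"
    by (auto simp: UNIV_bool)
  with st assms(2) trm_vars_pm_part [of s n] trm_vars_pm_part [of t n] show ?thesis
    by fastforce
qed

lemma atom_holds_pm_atom:
  assumes "is_atomic lang_L A"
    and "\<forall>i\<in>atom_vars A. x i = int (y (3 * i + 1)) - int (y (3 * i + 2))"
  shows "atom_holds nat_structure y (pm_atom A) \<longleftrightarrow> atom_holds int_structure x A"
proof -
  from assms(1) obtain s t where st: "A = Eq s t \<or> A = Rel Less [s, t]"
    "is_term lang_L s" "is_term lang_L t" "atom_vars A = trm_vars s \<union> trm_vars t"
    by (rule is_atomic_lang_L_cases)
  with assms(2) trm_val_pm_part [of s x y] trm_val_pm_part [of t x y] show ?thesis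
    by auto
qed

text \<open>
  The atom \<open>w\<^sub>j + t\<^sup>- = t\<^sup>+\<close>, which says that the fresh variable \<open>w\<^sub>j\<close> (of index \<open>3 * j + 3\<close>, as
  variable indices start from \<open>1\<close>) is the value of \<open>t\<close>. Over \<open>\<nat>\<close> it thereby also forces
  this value to be nonnegative.
\<close>

abbreviation value_atom :: "nat \<Rightarrow> fsym trm \<Rightarrow> (fsym, psym) atom" where
  "value_atom j t \<equiv> Eq (Var (3 * j + 3) \<^bold>+ pm_part False t) (pm_part True t)"

lemma substratum_int_imp_nat:
  assumes "has_functional_conceptual_substratum lang_L int_structure r (map int ` D)"
  shows "has_functional_conceptual_substratum lang_L_minus nat_structure r D"
proof -
  from assms obtain n ts As where
    len: "length ts = r" and
    ts: "\<forall>t\<in>set ts. is_term lang_L t \<and> trm_vars t \<subseteq> {1..n}" and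
    As: "\<forall>A\<in>set As. is_atomic lang_L A \<and> atom_vars A \<subseteq> {1..n}" and
    D: "\<And>a. length a = r \<Longrightarrow> a \<in> map int ` D \<longleftrightarrow>
          (\<exists>x. (\<forall>i<r. a ! i = trm_val int_structure x (ts ! i)) \<and>
               (\<forall>A\<in>set As. atom_holds int_structure x A))"
    unfolding has_functional_conceptual_substratum_def by auto
  define N where "N = 3 * (n + r) + 2"
  define us where "us = map (\<lambda>j. Var (3 * j + 3) :: fsym trm) [0..<r]"
  define Bs where "Bs = map (\<lambda>j. value_atom j (ts ! j)) [0..<r] @ map pm_atom As"
  \<comment> \<open>Every \<open>y\<close> over the natural numbers determines such an \<open>x\<close>, and every \<open>x\<close> over the integers
    arises from some \<open>y\<close>; so this one equivalence serves both inclusions.\<close>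
  have transfer: "(\<forall>j<r. a ! j = trm_val nat_structure y (us ! j)) \<and>
        (\<forall>B\<in>set Bs. atom_holds nat_structure y B) \<longleftrightarrow>
      (\<forall>j<r. a ! j = y (3 * j + 3)) \<and>
        (\<forall>j<r. int (a ! j) = trm_val int_structure x (ts ! j)) \<and>
        (\<forall>A\<in>set As. atom_holds int_structure x A)"
    if xy: "\<forall>i. x i = int (y (3 * i + 1)) - int (y (3 * i + 2))" for x y a
  proof -
    have "atom_holds nat_structure y (value_atom j (ts ! j)) \<longleftrightarrow>
        int (y (3 * j + 3)) = trm_val int_structure x (ts ! j)" if "j < r" for j
      using trm_val_pm_part [of "ts ! j" x y] ts len that xy by auto
    moreover have "atom_holds nat_structure y (pm_atom A) \<longleftrightarrow> atom_holds int_structure x A"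
      if "A \<in> set As" for A
      using atom_holds_pm_atom [of A x y] As that xy by auto
    ultimately show ?thesis
      by (auto simp: us_def Bs_def ball_Un simp del: atom_holds.simps)
  qed
  have "a \<in> D \<longleftrightarrow>
          (\<exists>y. (\<forall>j<r. a ! j = trm_val nat_structure y (us ! j)) \<and>
               (\<forall>B\<in>set Bs. atom_holds nat_structure y B))"
    (is "_ \<longleftrightarrow> ?R") if a: "length a = r" for a
  proof -
    have "a \<in> D \<longleftrightarrow> map int a \<in> map int ` D"
      by (simp add: inj_image_mem_iff)
    also have "\<dots> \<longleftrightarrow> (\<exists>x. (\<forall>j<r. int (a ! j) = trm_val int_structure x (ts ! j)) \<and>
                            (\<forall>A\<in>set As. atom_holds int_structure x A))"
      using D [of "map int a"] a by auto
    also have "\<dots> \<longleftrightarrow> ?R"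
    proof
      assume "\<exists>x. (\<forall>j<r. int (a ! j) = trm_val int_structure x (ts ! j)) \<and>
                   (\<forall>A\<in>set As. atom_holds int_structure x A)"
      then obtain x where x: "\<forall>j<r. int (a ! j) = trm_val int_structure x (ts ! j)"
        "\<forall>A\<in>set As. atom_holds int_structure x A" by blast
      \<comment> \<open>An integer is the difference of its truncation and that of its negative; the third clause
        shifts by \<open>1\<close> because the index \<open>3 * j + 3\<close> belongs to \<open>w\<^sub>j\<close>.\<close>
      define y where "y k = (if k mod 3 = 1 then nat (x (k div 3))
        else if k mod 3 = 2 then nat (- x (k div 3)) else a ! (k div 3 - 1))" for k
      have "y (3 * i + 1) = nat (x i)" "y (3 * i + 2) = nat (- x i)" "y (3 * i + 3) = a ! i" for i
        unfolding y_def by (simp_all add: mod_Suc div_Suc)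
      then show ?R using x transfer [of x y a] by (intro exI [of _ y]) auto
    next
      assume ?R
      then obtain y where "(\<forall>j<r. a ! j = trm_val nat_structure y (us ! j)) \<and>
        (\<forall>B\<in>set Bs. atom_holds nat_structure y B)" by blast
      then show "\<exists>x. (\<forall>j<r. int (a ! j) = trm_val int_structure x (ts ! j)) \<and>
                   (\<forall>A\<in>set As. atom_holds int_structure x A)"
        using transfer [of "\<lambda>i. int (y (3 * i + 1)) - int (y (3 * i + 2))" y a] by blast
    qed
    finally show ?thesis .
  qed
  moreover have "length us = r"
    by (simp add: us_def)
  moreover have "\<forall>u\<in>set us. is_term lang_L_minus u \<and> trm_vars u \<subseteq> {1..N}"
    by (auto simp: us_def N_def)
  moreover have "\<forall>B\<in>set Bs. is_atomic lang_L_minus B \<and> atom_vars B \<subseteq> {1..N}"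
  proof
    fix B assume "B \<in> set Bs"
    then consider j where "j < r" "B = value_atom j (ts ! j)" | A where "A \<in> set As" "B = pm_atom A"
      by (auto simp: Bs_def)
    then show "is_atomic lang_L_minus B \<and> atom_vars B \<subseteq> {1..N}"
    proof cases
      case 1
      with ts len have t: "is_term lang_L (ts ! j)" "trm_vars (ts ! j) \<subseteq> {1..n}" by auto
      have "trm_vars (pm_part b (ts ! j)) \<subseteq> {1..N}" for b
        using trm_vars_pm_part [OF t, of b] by (force simp: N_def)
      with 1 show ?thesis by (auto simp: is_term_pm_part [OF t(1)] N_def)
    next
      case 2
      with As have A: "is_atomic lang_L A" "atom_vars A \<subseteq> {1..n}" by auto
      have "atom_vars B \<subseteq> {1..N}"
        using atom_vars_pm_atom [OF A] 2 by (force simp: N_def)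
      with 2 is_atomic_pm_atom [OF A(1)] show ?thesis by simp
    qed
  qed
  ultimately show ?thesis
    unfolding has_functional_conceptual_substratum_def by blast
qed

theorem proposition2p2:
  fixes r :: nat and D :: "nat list set"
  assumes "r \<ge> 1" and "D \<subseteq> {a. length a = r}"
  shows "has_functional_conceptual_substratum lang_L_minus nat_structure r D \<longleftrightarrow>
         has_functional_conceptual_substratum lang_L int_structure r (map int ` D)"
  using substratum_nat_imp_int substratum_int_imp_nat by blast

end
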